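(* Let $M\in\mathrm{O}_{n_3}(\mathbb{R})$. Given a symmetric tensor $\mathcal{A}\in\mathbb{R}_M^{n\times n}$, we have $\mathcal{A}\in\mathrm{PSD}_M^n$ if and only if the matrix $(I_n\otimes M^\top)\,\mathrm{mat}_M(\mathcal{A})\,(I_n\otimes M)$ is positive semidefinite.
   Context: $\mathrm{O}_{n_3}(\mathbb{R})$ is the group of real orthogonal $n_3\times n_3$ matrices. A tube is an element $\mathbf{a}\in\mathbb{R}^{1\times1\times n_3}$; $\mathrm{vec}(\mathbf{a})\in\mathbb{R}^{n_3}$ has entries $\mathbf{a}_{1,1,k}$, and $\mathrm{tube}$ is the inverse of $\mathrm{vec}$; $\mathrm{diag}(v)$ is the diagonal matrix with diagonal $v$. The $\star_M$-product of tubes is $\mathbf{a}\star_M\mathbf{b}=\mathrm{tube}(M^{-1}\mathrm{diag}(M\mathrm{vec}(\mathbf{a}))M\mathrm{vec}(\mathbf{b}))$, and $\mathbb{R}_M$ is the resulting ring of tubes. $\mathbb{R}_M^{n_1\times n_2}$ denotes $\mathbb{R}^{n_1\times n_2\times n_3}$ viewed as $n_1\times n_2$ matrices of tubes $\mathcal{A}_{i,j,:}$, with product $(\mathcal{A}\star_M\mathcal{B})_{i,j,:}=\sum_\ell\mathcal{A}_{i,\ell,:}\star_M\mathcal{B}_{\ell,j,:}$; $\mathbb{R}_M^n=\mathbb{R}^{n\times1\times n_3}$. The inner product is $\langle\mathcal{A},\mathcal{B}\rangle=\sum_{i,j,k}\mathcal{A}_{i,j,k}\mathcal{B}_{i,j,k}$.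 A tensor $\mathcal{A}\in\mathbb{R}_M^{n\times n}$ is symmetric if every frontal slice $\mathcal{A}_{:,:,k}$ is a symmetric matrix. $\mathrm{PSD}_M^n$ is the set of $\star_M$-positive semidefinite tensors: symmetric $\mathcal{A}\in\mathbb{R}_M^{n\times n}$ with $\langle\mathcal{X},\mathcal{A}\star_M\mathcal{X}\rangle\ge0$ for all $\mathcal{X}\in\mathbb{R}_M^n$. $\mathrm{mat}_M(\mathcal{A})$ is the $nn_3\times nn_3$ block matrix whose $(i,j)$ block is the $n_3\times n_3$ diagonal matrix $\mathrm{diag}(M\mathrm{vec}(\mathcal{A}_{i,j,:}))$. $\otimes$ is the Kronecker product. *)

theory Defs
  imports "HOL-Analysis.Analysis"
begin

text \<open>
  A tube is identified with its vector of entries in \<open>real ^ 'k\<close>, where \<open>CARD('k)\<close> is \<open>n\<^sub>3\<close>, so that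
  \<open>vec\<close> and \<open>tube\<close> become identities. A third-order tensor of size \<open>n\<^sub>1 \<times> n\<^sub>2 \<times> n\<^sub>3\<close> is an
  \<open>n\<^sub>1 \<times> n\<^sub>2\<close> matrix of tubes: the entry \<open>(i, j, k)\<close> is \<open>A $ i $ j $ k\<close>, the tube
  \<open>(i, j, :)\<close> is \<open>A $ i $ j\<close>.
\<close>

definition diag :: "real ^ 'k \<Rightarrow> real ^ 'k ^ 'k" where
  "diag v = (\<chi> p q. if p = q then v $ p else 0)"

definition tube_mult :: "real ^ 'k ^ 'k \<Rightarrow> real ^ 'k \<Rightarrow> real ^ 'k \<Rightarrow> real ^ 'k" where
  "tube_mult M a b = (matrix_inv M ** diag (M *v a) ** M) *v b"

definition tensor_mult ::
  "real ^ 'k ^ 'k \<Rightarrow> real ^ 'k ^ 'l ^ 'm \<Rightarrow> real ^ 'k ^ 'n ^ 'l \<Rightarrow> real ^ 'k ^ 'n ^ 'm" where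
  "tensor_mult M A B = (\<chi> i j. \<Sum>l\<in>UNIV. tube_mult M (A $ i $ l) (B $ l $ j))"

text \<open>The inner product of tensors is the library's inner product on iterated vectors.\<close>

lemma inner_tensor:
  fixes A B :: "real ^ 'k ^ 'n ^ 'm"
  shows "A \<bullet> B = (\<Sum>i\<in>UNIV. \<Sum>j\<in>UNIV. \<Sum>k\<in>UNIV. A $ i $ j $ k * B $ i $ j $ k)"
  by (simp add: inner_vec_def)

definition frontal_slice :: "real ^ 'k ^ 'n ^ 'm \<Rightarrow> 'k \<Rightarrow> real ^ 'n ^ 'm" where
  "frontal_slice A k = (\<chi> i j. A $ i $ j $ k)"

definition symmetric_matrix :: "real ^ 'n ^ 'n \<Rightarrow> bool" where
  "symmetric_matrix B \<longleftrightarrow> transpose B = B"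

definition symmetric_tensor :: "real ^ 'k ^ 'n ^ 'n \<Rightarrow> bool" where
  "symmetric_tensor A \<longleftrightarrow> (\<forall>k. symmetric_matrix (frontal_slice A k))"

text \<open>The type \<open>1\<close> has a single element, so \<open>X\<close> below ranges over the \<open>n \<times> 1 \<times> n\<^sub>3\<close> tensors.\<close>

definition PSD_tensor :: "real ^ 'k ^ 'k \<Rightarrow> (real ^ 'k ^ 'n ^ 'n) set" where
  "PSD_tensor M =
    {A. symmetric_tensor A \<and> (\<forall>X :: real ^ 'k ^ 1 ^ 'n. X \<bullet> tensor_mult M A X \<ge> 0)}"

definition psd_matrix :: "real ^ 'n ^ 'n \<Rightarrow> bool" where
  "psd_matrix B \<longleftrightarrow> symmetric_matrix B \<and> (\<forall>x. x \<bullet> (B *v x) \<ge> 0)"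

text \<open>
  Rows and columns of a block matrix are indexed by pairs: \<open>(i, p)\<close> is position \<open>p\<close> within
  block \<open>i\<close>.
\<close>

definition kronecker ::
  "real ^ 'b ^ 'a \<Rightarrow> real ^ 'd ^ 'c \<Rightarrow> real ^ ('b \<times> 'd) ^ ('a \<times> 'c)" where
  "kronecker A B = (\<chi> r s. A $ fst r $ fst s * B $ snd r $ snd s)"

definition mat_tensor ::
  "real ^ 'k ^ 'k \<Rightarrow> real ^ 'k ^ 'n ^ 'm \<Rightarrow> real ^ ('n \<times> 'k) ^ ('m \<times> 'k)" where
  "mat_tensor M A = (\<chi> r s. diag (M *v (A $ fst r $ fst s)) $ snd r $ snd s)"

end

theory Submission
  imports Defs
begin

text \<open>
  The \<open>(i, j)\<close> block of \<open>(I \<otimes> M\<^sup>T) mat(A) (I \<otimes> M)\<close> is the matrix of multiplication by the tube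
  \<open>A\<^sub>i\<^sub>j\<close>, because \<open>M\<^sup>T = M\<^sup>-\<^sup>1\<close>. Hence the block matrix represents \<open>X \<mapsto> A \<star> X\<close> after stacking
  the tubes of \<open>X\<close>, and stacking is an isometry onto the space of vectors.
\<close>

lemma matrix_inv_orthogonal:
  fixes M :: "real ^ 'k ^ 'k"
  assumes "orthogonal_matrix M"
  shows "matrix_inv M = transpose M"
proof -
  \<comment> \<open>\<open>matrix_inv\<close> is a Hilbert choice. The witness
    \<open>transpose M\<close> shows that the chosen matrix is a two-sided inverse, and cancelling
    \<open>M\<close> then identifies the two.\<close>
  have "M ** matrix_inv M = mat 1 \<and> matrix_inv M ** M = mat 1"
    unfolding matrix_inv_def
    by (rule someI[of _ "transpose M"]) (use assms in \<open>auto simp: orthogonal_matrix_def\<close>)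
  then have "transpose M ** (M ** matrix_inv M) = transpose M"
    by simp
  then show ?thesis
    using assms by (simp add: matrix_mul_assoc orthogonal_matrix_def)
qed

lemma symmetric_tensor_swap:
  assumes "symmetric_tensor A"
  shows "A $ i $ j = A $ j $ i"
  using assms
  by (auto simp: symmetric_tensor_def symmetric_matrix_def frontal_slice_def transpose_def vec_eq_iff)

lemma sum_UNIV_prod:
  fixes f :: "'a::finite \<times> 'b::finite \<Rightarrow> real"
  shows "(\<Sum>r\<in>UNIV. f r) = (\<Sum>i\<in>UNIV. \<Sum>p\<in>UNIV. f (i, p))"
  by (simp add: sum.cartesian_product UNIV_Times_UNIV)

text \<open>The identity factor removes every block \<open>a\<close> other than \<open>i\<close>, so
  \<open>B\<close> acts on the positions inside block \<open>i\<close> alone.\<close>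

lemma kronecker_mat_1_mult_left:
  fixes B :: "real ^ 'k ^ 'l" and C :: "real ^ 's ^ ('n::finite \<times> 'k::finite)"
  shows "(kronecker (mat 1 :: real ^ 'n ^ 'n) B ** C) $ (i, p) $ s
    = (\<Sum>t\<in>UNIV. B $ p $ t * C $ (i, t) $ s)"
proof -
  have "(kronecker (mat 1 :: real ^ 'n ^ 'n) B ** C) $ (i, p) $ s
      = (\<Sum>a\<in>UNIV. if i = a then \<Sum>t\<in>UNIV. B $ p $ t * C $ (a, t) $ s else 0)"
    unfolding matrix_matrix_mult_def kronecker_def mat_def vec_lambda_beta sum_UNIV_prod
    by (rule sum.cong) simp_all
  then show ?thesis by simp
qed

lemma kronecker_mat_1_mult_right:
  fixes B :: "real ^ 'l ^ 'k" and C :: "real ^ ('n::finite \<times> 'k::finite) ^ 's"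
  shows "(C ** kronecker (mat 1 :: real ^ 'n ^ 'n) B) $ s $ (j, q)
    = (\<Sum>t\<in>UNIV. C $ s $ (j, t) * B $ t $ q)"
proof -
  have "(C ** kronecker (mat 1 :: real ^ 'n ^ 'n) B) $ s $ (j, q)
      = (\<Sum>a\<in>UNIV. if a = j then \<Sum>t\<in>UNIV. C $ s $ (a, t) * B $ t $ q else 0)"
    unfolding matrix_matrix_mult_def kronecker_def mat_def vec_lambda_beta sum_UNIV_prod
    by (rule sum.cong) simp_all
  then show ?thesis by simp
qed

lemma kronecker_conj_mat_tensor_nth:
  fixes M :: "real ^ 'k ^ 'k" and A :: "real ^ 'k ^ 'n ^ 'm"
  shows "(kronecker (mat 1 :: real ^ 'm ^ 'm) (transpose M) ** mat_tensor M A
      ** kronecker (mat 1 :: real ^ 'n ^ 'n) M) $ (i, p) $ (j, q)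
    = (transpose M ** diag (M *v (A $ i $ j)) ** M) $ p $ q"
  by (simp add: kronecker_mat_1_mult_right kronecker_mat_1_mult_left)
     (simp add: mat_tensor_def matrix_matrix_mult_def)

text \<open>The outer factors are transposes of each other and \<open>diag v\<close> is symmetric.
  This gives the symmetry inside a single block.\<close>

lemma transpose_conj_diag:
  fixes M :: "real ^ 'k ^ 'k"
  shows "transpose (transpose M ** diag v ** M) = transpose M ** diag v ** M"
proof -
  have "transpose (diag v) = diag v"
    by (auto simp: diag_def transpose_def vec_eq_iff)
  then show ?thesis
    by (simp add: matrix_transpose_mul matrix_mul_assoc)
qed

definition stack :: "real ^ 'k ^ 1 ^ 'n \<Rightarrow> real ^ ('n \<times> 'k)" where
  "stack X = (\<chi> r. X $ fst r $ 1 $ snd r)"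

lemma inner_stack: "stack X \<bullet> stack Y = X \<bullet> Y"
  by (simp add: inner_vec_def stack_def sum_UNIV_prod)

lemma surj_stack: "surj stack"
proof (rule surjI)
  show "stack (\<chi> i j p. x $ (i, p)) = x" for x :: "real ^ ('n::finite \<times> 'k::finite)"
    by (simp add: stack_def vec_eq_iff)
qed

lemma kronecker_conj_mat_tensor_stack:
  fixes M :: "real ^ 'k ^ 'k" and A :: "real ^ 'k ^ 'n ^ 'm"
  assumes "orthogonal_matrix M"
  shows "(kronecker (mat 1 :: real ^ 'm ^ 'm) (transpose M) ** mat_tensor M A
      ** kronecker (mat 1 :: real ^ 'n ^ 'n) M) *v stack X = stack (tensor_mult M A X)"
proof -
  have "((kronecker (mat 1 :: real ^ 'm ^ 'm) (transpose M) ** mat_tensor M A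
      ** kronecker (mat 1 :: real ^ 'n ^ 'n) M) *v stack X) $ (i, p)
    = (\<Sum>j\<in>UNIV. tube_mult M (A $ i $ j) (X $ j $ 1) $ p)" for i p
    \<comment> \<open>The instance unfolds only the product with the large matrix, so that
      \<open>M *v (A $ i $ j)\<close> stays folded inside the blocks. The second \<open>simp\<close>
      then matches the sum over positions with the tube product.\<close>
    by (simp add: matrix_vector_mult_def[of "_ ** kronecker _ _"] sum_UNIV_prod
        kronecker_conj_mat_tensor_nth tube_mult_def matrix_inv_orthogonal[OF assms] stack_def)
       (simp add: matrix_vector_mult_def)
  then show ?thesis
    by (simp add: vec_eq_iff stack_def tensor_mult_def)
qed

theorem proposition3p2:
  fixes M :: "real ^ 'k ^ 'k" and A :: "real ^ 'k ^ 'n ^ 'n"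
  assumes "orthogonal_matrix M"
    and "symmetric_tensor A"
  shows "A \<in> PSD_tensor M \<longleftrightarrow>
    psd_matrix (kronecker (mat 1 :: real ^ 'n ^ 'n) (transpose M) ** mat_tensor M A
      ** kronecker (mat 1 :: real ^ 'n ^ 'n) M)"
proof -
  let ?K = "kronecker (mat 1 :: real ^ 'n ^ 'n) (transpose M) ** mat_tensor M A
      ** kronecker (mat 1 :: real ^ 'n ^ 'n) M"
  \<comment> \<open>Positive semidefiniteness of a matrix includes symmetry, which is checked in two
    moves: symmetry of \<open>A\<close> exchanges the blocks \<open>(j, i)\<close> and
    \<open>(i, j)\<close>, and symmetry of the block exchanges \<open>q\<close> and
    \<open>p\<close>.\<close>
  have "?K $ (j, q) $ (i, p) = ?K $ (i, p) $ (j, q)" for i j p q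
  proof -
    let ?T = "transpose M ** diag (M *v (A $ i $ j)) ** M"
    have "?K $ (j, q) $ (i, p) = ?T $ q $ p"
      by (simp only: kronecker_conj_mat_tensor_nth symmetric_tensor_swap[OF assms(2), of j i])
    also have "\<dots> = transpose ?T $ p $ q"
      by (simp add: transpose_def)
    also have "\<dots> = ?K $ (i, p) $ (j, q)"
      by (simp only: kronecker_conj_mat_tensor_nth transpose_conj_diag)
    finally show ?thesis .
  qed
  then have "transpose ?K = ?K"
    by (simp add: transpose_def[of ?K] vec_eq_iff)
  \<comment> \<open>Every vector is a stacked tensor, so testing the quadratic form on stacked
    tensors suffices.\<close>
  moreover have "(\<forall>x. x \<bullet> (?K *v x) \<ge> 0)
      \<longleftrightarrow> (\<forall>X :: real ^ 'k ^ 1 ^ 'n. stack X \<bullet> (?K *v stack X) \<ge> 0)"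
    using surj_stack by (metis surjD)
  ultimately show ?thesis
    using assms(2)
    by (simp add: PSD_tensor_def psd_matrix_def symmetric_matrix_def
        kronecker_conj_mat_tensor_stack[OF assms(1)] inner_stack)
qed

end
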